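(* Let $q\ge1$, $T>0$, $\alpha>0$, and let $f\in\mathcal C^q(0,T]$, where $f$ extends to an analytic function on an open subset of $\mathbb C$ containing $(0,T]$. Let $t_n\in(0,T)$ be a time node, $t_{n+1}=t_n+\tau$ and $r=\tau/\alpha$. Then, as $\tau\to0$ with $\alpha$ fixed, $$\frac rq\,\mathbb 1^{\mathrm T}\mathbf B(\alpha)\mathbf f^{[n]}-\int_{t_n}^{t_{n+1}}f(t)\,\mathrm dt=\mathcal O(\tau^q),$$ with implied constant independent of $\tau$.
   Context: Let $\omega_j=e^{2\pi i j/q}$, $j=1,\dots,q$. $\mathbb 1$ is the all-one column vector of length $q$. $\mathbf f^{[n]}$ is the column vector with entries $f(t_n+r\omega_j)$, $j=1,\dots,q$ (values of $f$ at complex time nodes). $\mathbf B(\alpha)=\mathbf S(\alpha)\mathbf F$, where $\mathbf S(\alpha)$ is the $q\times q$ matrix with entries $\int_0^{\alpha+\omega_j}x^{k-1}\,\mathrm dx=(\alpha+\omega_j)^k/k$ (row $j$, column $k$) and $\mathbf F$ is the $q\times q$ matrix with entries $\mathbf F_{j,k}=\frac1q\omega_k^{1-j}$. *)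

theory Defs
  imports
    "HOL-Complex_Analysis.Complex_Analysis"
    "HOL-Library.Landau_Symbols"
    "Jordan_Normal_Form.Matrix"
begin

text \<open>
  One-sided derivatives are taken at those end points that belong to the interval,
  via \<^term>\<open>at t within S\<close>. The witness \<open>D i\<close> is the \<open>i\<close>-th derivative of \<open>f\<close> on \<open>S\<close>.
\<close>

definition Ck_on :: "nat \<Rightarrow> real set \<Rightarrow> (real \<Rightarrow> complex) \<Rightarrow> bool" where
  "Ck_on k S f \<longleftrightarrow>
     (\<exists>D :: nat \<Rightarrow> real \<Rightarrow> complex.
        (\<forall>t\<in>S. D 0 t = f t) \<and>
        (\<forall>i<k. \<forall>t\<in>S. (D i has_vector_derivative D (Suc i) t) (at t within S)) \<and>
        (\<forall>i\<le>k. continuous_on S (D i)))"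

definition node :: "nat \<Rightarrow> nat \<Rightarrow> complex" where
  "node q j = exp (2 * of_real pi * \<i> * of_nat j / of_nat q)"

text \<open>
  The mathematical indices \<open>j, k\<close> run through \<open>1, \<dots>, q\<close>, whereas the library's vectors and
  matrices are indexed from \<open>0\<close>. Position \<open>i\<close> therefore carries the mathematical index \<open>Suc i\<close>.
\<close>

definition ones_vec :: "nat \<Rightarrow> complex vec" where
  "ones_vec q = Matrix.vec q (\<lambda>_. 1)"

definition sample_vec :: "nat \<Rightarrow> (complex \<Rightarrow> complex) \<Rightarrow> real \<Rightarrow> real \<Rightarrow> complex vec" where
  "sample_vec q F t r = Matrix.vec q (\<lambda>i. F (of_real t + of_real r * node q (Suc i)))"

definition S_mat :: "nat \<Rightarrow> real \<Rightarrow> complex mat" where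
  "S_mat q \<alpha> = Matrix.mat q q (\<lambda>(i, l).
     contour_integral (linepath 0 (of_real \<alpha> + node q (Suc i))) (\<lambda>x. x ^ (Suc l - 1)))"

definition F_mat :: "nat \<Rightarrow> complex mat" where
  "F_mat q = Matrix.mat q q (\<lambda>(i, l).
     1 / of_nat q * node q (Suc l) powi (1 - int (Suc i)))"

definition B_mat :: "nat \<Rightarrow> real \<Rightarrow> complex mat" where
  "B_mat q \<alpha> = S_mat q \<alpha> * F_mat q"

lemma contour_integral_monomial:
  "contour_integral (linepath 0 z) (\<lambda>x. x ^ (Suc l - 1)) = z ^ Suc l / of_nat (Suc l)"
proof -
  have "((\<lambda>x. x ^ Suc l / of_nat (Suc l)) has_field_derivative x ^ l) (at x within UNIV)"
    for x :: complex
  proof -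
    have "((\<lambda>x. x ^ Suc l / of_nat (Suc l)) has_field_derivative
             (of_nat (Suc l) * x ^ l) / of_nat (Suc l)) (at x within UNIV)"
      by (rule DERIV_cdivide) (use DERIV_power[OF DERIV_ident, of "Suc l" x] in simp)
    then show ?thesis
      by (simp del: of_nat_Suc)
  qed
  then have "((\<lambda>x. x ^ l) has_contour_integral
      (pathfinish (linepath 0 z) ^ Suc l / of_nat (Suc l) -
       pathstart (linepath 0 z) ^ Suc l / of_nat (Suc l))) (linepath 0 z)"
    by (intro contour_integral_primitive[where S = UNIV] valid_path_linepath) blast+
  then show ?thesis
    by (simp add: contour_integral_unique)
qed

lemma S_mat_eq:
  "S_mat q \<alpha> = Matrix.mat q q (\<lambda>(i, l).
     (of_real \<alpha> + node q (Suc i)) ^ Suc l / of_nat (Suc l))"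
  unfolding S_mat_def contour_integral_monomial ..

end

theory Submission
  imports Defs
begin

text \<open>
  Orthogonality of the roots of unity collapses \<open>1\<^sup>T B(\<alpha>)\<close>: on a monomial of degree below
  \<open>q\<close> the quadrature rule is exact up to one term of size \<open>r ^ q / q\<close>. Expanding \<open>F\<close> at \<open>t\<^sub>n\<close> to
  degree \<open>q - 1\<close> leaves a Taylor remainder \<open>O(|z| ^ q)\<close>, which contributes only
  \<open>O(\<tau> ^ (q + 1))\<close> to the rule, whose weights are \<open>r\<close> times constants, and to the integral.
\<close>

section \<open>Power sums of the roots of unity\<close>

lemma node_powi: "node q j powi k = (node q 1 powi k) ^ j"
proof -
  have "node q j = node q 1 ^ j"
    unfolding node_def by (simp flip: exp_of_nat_mult add: field_simps)
  then show ?thesis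
    by (simp add: power_int_power power_int_power' mult.commute)
qed

lemma node_1_powi_eq_1_iff:
  assumes "q \<ge> 1"
  shows "node q 1 powi k = 1 \<longleftrightarrow> int q dvd k"
proof -
  have "node q 1 powi k = exp (of_real (2 * pi * of_int k / of_nat q) * \<i>)"
    unfolding node_def exp_power_int by (simp add: field_simps)
  also have "\<dots> = 1 \<longleftrightarrow> (\<exists>n::int. 2 * pi * of_int k / of_nat q = of_int (2 * n) * pi)"
    by (subst exp_eq_1) simp
  also have "\<dots> \<longleftrightarrow> (\<exists>n::int. k = int q * n)"
  proof (intro ex_cong1)
    fix n :: int
    have "2 * pi * of_int k / of_nat q = of_int (2 * n) * pi \<longleftrightarrow> real_of_int k = of_int (int q * n)"
      using assms by (simp add: field_simps)
    then show "2 * pi * of_int k / of_nat q = of_int (2 * n) * pi \<longleftrightarrow> k = int q * n"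
      using of_int_eq_iff by metis
  qed
  finally show ?thesis
    unfolding dvd_def .
qed

text \<open>A geometric sum with ratio \<open>z = node q 1 powi k\<close>: either the ratio is 1, or
  \<open>z ^ q = 1\<close> makes the sum vanish. Integer exponents are allowed because the entries
  of \<open>F_mat\<close> are negative powers of the nodes.\<close>

lemma sum_node_powi:
  assumes "q \<ge> 1"
  shows "(\<Sum>j<q. node q (Suc j) powi k) = (if int q dvd k then of_nat q else 0)"
proof (cases "int q dvd k")
  case True
  then have "node q 1 powi k = 1"
    using node_1_powi_eq_1_iff[OF assms] by blast
  then have "node q (Suc j) powi k = 1" for j
    by (simp only: node_powi[of q "Suc j"] power_one)
  with True show ?thesis
    by simp
next
  case False
  define z where "z = node q 1 powi k"
  have "z \<noteq> 1"
    using False node_1_powi_eq_1_iff[OF assms] unfolding z_def by blast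
  have "z ^ q = node q q powi k"
    unfolding z_def by (rule node_powi[symmetric])
  also have "node q q = 1"
    using assms by (simp add: node_def mult.commute)
  finally have "z ^ q = 1"
    by simp
  have "(\<Sum>j<q. node q (Suc j) powi k) = z * (\<Sum>j<q. z ^ j)"
    unfolding z_def by (subst node_powi) (simp add: sum_distrib_left)
  also have "\<dots> = 0"
    using \<open>z \<noteq> 1\<close> \<open>z ^ q = 1\<close> by (simp add: geometric_sum)
  finally show ?thesis
    using False by simp
qed

section \<open>The weights of the rule and its action on monomials\<close>

text \<open>After binomial expansion, summing over the nodes kills every power whose exponent is not
  divisible by \<open>q\<close>. Exponents run up to \<open>Suc l \<le> q\<close>, so only 0
  survives, and also \<open>q\<close> itself when \<open>Suc l = q\<close>; the latter contributes
  \<open>q / Suc l = 1\<close>.\<close>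

lemma sum_S_mat_column:
  assumes "q \<ge> 1" "l < q"
  shows "(\<Sum>i<q. S_mat q \<alpha> $$ (i, l))
    = of_nat q * of_real \<alpha> ^ Suc l / of_nat (Suc l) + (if Suc l = q then 1 else 0)"
proof -
  have *: "(\<Sum>i<q. node q (Suc i) ^ k) = (if q dvd k then of_nat q else 0)" for k
    using sum_node_powi[OF assms(1), of "int k"] by simp
  have "(\<Sum>i<q. (of_real \<alpha> + node q (Suc i)) ^ Suc l)
      = (\<Sum>i<q. \<Sum>k\<le>Suc l. of_nat (Suc l choose k) * node q (Suc i) ^ k * of_real \<alpha> ^ (Suc l - k))"
    by (subst add.commute) (simp only: binomial_ring)
  also have "\<dots> = (\<Sum>k\<le>Suc l. of_nat (Suc l choose k) * of_real \<alpha> ^ (Suc l - k) * (\<Sum>i<q. node q (Suc i) ^ k))"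
    by (subst sum.swap) (simp add: sum_distrib_left mult_ac)
  \<comment> \<open>The surviving indices 0 and \<open>Suc l\<close> are distinct, so their
    contributions can be written as two independent delta terms.\<close>
  also have "\<dots> = (\<Sum>k\<le>Suc l. (if k = 0 then of_nat q * of_real \<alpha> ^ Suc l else 0)
      + (if k = Suc l then (if Suc l = q then of_nat q else 0) else 0))"
  proof (intro sum.cong refl)
    fix k assume "k \<in> {..Suc l}"
    then have "q dvd k \<longleftrightarrow> k = 0 \<or> k = Suc l \<and> Suc l = q"
      using assms by (auto dest: dvd_imp_le)
    then show "of_nat (Suc l choose k) * of_real \<alpha> ^ (Suc l - k) * (\<Sum>i<q. node q (Suc i) ^ k)
      = (if k = 0 then of_nat q * complex_of_real \<alpha> ^ Suc l else 0)
      + (if k = Suc l then (if Suc l = q then of_nat q else 0) else 0)"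
      unfolding * by auto
  qed
  also have "\<dots> = of_nat q * of_real \<alpha> ^ Suc l + (if Suc l = q then of_nat q else 0)"
    by (subst sum.distrib) (simp only: sum.delta finite_atMost atMost_iff le0 order_refl if_True)
  finally have "(\<Sum>i<q. (of_real \<alpha> + node q (Suc i)) ^ Suc l) / of_nat (Suc l)
      = (of_nat q * of_real \<alpha> ^ Suc l + (if Suc l = q then of_nat q else 0)) / of_nat (Suc l)"
    by simp
  then show ?thesis
    using assms(2) by (auto simp: S_mat_eq sum_divide_distrib add_divide_distrib simp del: power_Suc of_nat_Suc)
qed

text \<open>Entry \<open>m\<close> of the row vector 1^T B(\<alpha>), bracketed as (1^T S) F so that
  the column sums of \<open>S_mat\<close> appear. Position \<open>m\<close> belongs to the node with
  index \<open>Suc m\<close>.\<close>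

definition quad_weight :: "nat \<Rightarrow> real \<Rightarrow> nat \<Rightarrow> complex" where
  "quad_weight q \<alpha> m = (\<Sum>l<q. (\<Sum>i<q. S_mat q \<alpha> $$ (i, l)) * F_mat q $$ (l, m))"

lemma scalar_prod_B_mat:
  "scalar_prod (ones_vec q) (B_mat q \<alpha> *\<^sub>v Matrix.vec q g) = (\<Sum>m<q. quad_weight q \<alpha> m * g m)"
proof -
  have dims: "dim_row (S_mat q \<alpha>) = q" "dim_col (S_mat q \<alpha>) = q"
       "dim_row (F_mat q) = q" "dim_col (F_mat q) = q"
    by (simp_all add: S_mat_def F_mat_def)
  have "scalar_prod (ones_vec q) (B_mat q \<alpha> *\<^sub>v Matrix.vec q g)
    = (\<Sum>i<q. \<Sum>m<q. (\<Sum>l<q. S_mat q \<alpha> $$ (i, l) * F_mat q $$ (l, m)) * g m)"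
    by (simp add: scalar_prod_def ones_vec_def B_mat_def dims atLeast0LessThan)
  also have "\<dots> = (\<Sum>m<q. \<Sum>i<q. \<Sum>l<q. S_mat q \<alpha> $$ (i, l) * F_mat q $$ (l, m) * g m)"
    by (subst sum.swap) (simp add: sum_distrib_right)
  also have "\<dots> = (\<Sum>m<q. \<Sum>l<q. \<Sum>i<q. S_mat q \<alpha> $$ (i, l) * F_mat q $$ (l, m) * g m)"
    by (intro sum.cong refl sum.swap)
  finally show ?thesis
    by (simp add: quad_weight_def sum_distrib_right)
qed

text \<open>\<open>F_mat\<close> is the inverse discrete Fourier transform, that is, the inverse of
  the Vandermonde matrix of the nodes. It sends the samples of the \<open>n\<close>-th power to the
  \<open>n\<close>-th unit vector, which picks out column \<open>n\<close> of
  \<open>S_mat\<close>.\<close>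

lemma sum_quad_weight_power:
  assumes "q \<ge> 1" "n < q"
  shows "(\<Sum>m<q. quad_weight q \<alpha> m * node q (Suc m) ^ n)
    = of_nat q * of_real \<alpha> ^ Suc n / of_nat (Suc n) + (if Suc n = q then 1 else 0)"
proof -
  have F: "(\<Sum>m<q. F_mat q $$ (l, m) * node q (Suc m) ^ n) = (if l = n then 1 else 0)"
    if "l < q" for l
  proof -
    have "(\<Sum>m<q. F_mat q $$ (l, m) * node q (Suc m) ^ n)
      = (\<Sum>m<q. node q (Suc m) powi (int n - int l)) / of_nat q"
      unfolding sum_divide_distrib
    proof (intro sum.cong refl)
      fix m assume "m \<in> {..<q}"
      have "node q (Suc m) \<noteq> 0"
        by (simp add: node_def)
      then have "node q (Suc m) powi (- int l) * node q (Suc m) ^ n = node q (Suc m) powi (int n - int l)"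
        by (simp flip: power_int_of_nat power_int_add)
      then show "F_mat q $$ (l, m) * node q (Suc m) ^ n = node q (Suc m) powi (int n - int l) / of_nat q"
        using that \<open>m \<in> {..<q}\<close> by (simp add: F_mat_def)
    qed
    \<comment> \<open>Both \<open>l\<close> and \<open>n\<close> are below \<open>q\<close>, so
      congruence modulo \<open>q\<close> forces equality.\<close>
    moreover have "int q dvd int n - int l \<longleftrightarrow> l = n"
    proof
      assume "int q dvd int n - int l"
      then have "int n mod int q = int l mod int q"
        by (simp add: mod_eq_dvd_iff)
      with that assms(2) show "l = n"
        by simp
    qed simp
    ultimately show ?thesis
      using assms(1) by (simp add: sum_node_powi)
  qed
  have "(\<Sum>m<q. quad_weight q \<alpha> m * node q (Suc m) ^ n)
    = (\<Sum>l<q. (\<Sum>i<q. S_mat q \<alpha> $$ (i, l)) * (\<Sum>m<q. F_mat q $$ (l, m) * node q (Suc m) ^ n))"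
    unfolding quad_weight_def sum_distrib_right[where A = "{..<q}" and r = "_ ^ n"] sum_distrib_left mult.assoc
    by (rule sum.swap)
  also have "\<dots> = (\<Sum>l<q. if l = n then \<Sum>i<q. S_mat q \<alpha> $$ (i, l) else 0)"
    by (intro sum.cong refl) (simp add: F)
  also have "\<dots> = (\<Sum>i<q. S_mat q \<alpha> $$ (i, n))"
    using assms(2) by simp
  finally show ?thesis
    by (simp only: sum_S_mat_column[OF assms])
qed

text \<open>The rule integrates every monomial of degree below \<open>q - 1\<close> exactly; the wrap-around
  \<open>\<omega>\<^sub>j ^ q = 1\<close> produces the defect in degree \<open>q - 1\<close>.\<close>

lemma quadrature_monomial:
  fixes r \<alpha> :: real
  assumes "q \<ge> 1" "n < q"
  shows "of_real r / of_nat q * (\<Sum>m<q. quad_weight q \<alpha> m * (of_real r * node q (Suc m)) ^ n)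
    = of_real (r * \<alpha>) ^ Suc n / of_nat (Suc n) + (if Suc n = q then of_real r ^ q / of_nat q else 0)"
proof -
  \<comment> \<open>The step size in front joins \<open>r ^ n\<close> from the samples; this is why
    the defect for \<open>n = q - 1\<close> has order \<open>r ^ q\<close>.\<close>
  have "of_real r / of_nat q * (\<Sum>m<q. quad_weight q \<alpha> m * (of_real r * node q (Suc m)) ^ n)
    = of_real r ^ Suc n / of_nat q * (\<Sum>m<q. quad_weight q \<alpha> m * node q (Suc m) ^ n)"
    by (simp add: power_mult_distrib sum_distrib_left mult_ac)
  also have "\<dots> = of_real (r * \<alpha>) ^ Suc n / of_nat (Suc n)
      + (if Suc n = q then of_real r ^ q / of_nat q else 0)"
    unfolding sum_quad_weight_power[OF assms]
    using assms(1) by (auto simp: power_mult_distrib distrib_left field_simps simp del: of_nat_Suc)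
  finally show ?thesis .
qed

section \<open>Taylor remainder and integrals of shifted powers\<close>

text \<open>On a closed disc inside \<open>U\<close> the \<open>q\<close>-th derivative is bounded
  by compactness, and the disc is convex, so Taylor's theorem applies with one constant for all
  \<open>z\<close> in the disc.\<close>

lemma analytic_Taylor_remainder:
  fixes F :: "complex \<Rightarrow> complex"
  assumes "open U" "F holomorphic_on U" "c \<in> U" "q \<ge> 1"
  obtains e C where "e > 0" "cball c e \<subseteq> U"
    "\<And>z. z \<in> cball c e \<Longrightarrow>
      norm (F z - (\<Sum>n<q. (deriv ^^ n) F c / fact n * (z - c) ^ n)) \<le> C * norm (z - c) ^ q"
proof -
  obtain e where e: "e > 0" "cball c e \<subseteq> U"
    using assms open_contains_cball by blast
  have hol: "(deriv ^^ n) F holomorphic_on U" for n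
    using assms by (intro holomorphic_higher_deriv)
  have "compact ((deriv ^^ q) F ` cball c e)"
    using hol e(2) by (intro compact_continuous_image holomorphic_on_imp_continuous_on)
      (rule holomorphic_on_subset, auto)
  then obtain B where B: "\<And>z. z \<in> cball c e \<Longrightarrow> norm ((deriv ^^ q) F z) \<le> B"
    using compact_imp_bounded[THEN bounded_iff[THEN iffD1]] by (metis imageI)
  \<comment> \<open>\<open>complex_Taylor\<close> keeps the terms up to degree \<open>p\<close> and
    leaves a remainder of order \<open>Suc p\<close>, hence \<open>p = q - 1\<close>.\<close>
  obtain p where p: "q = Suc p"
    using assms(4) by (cases q) auto
  show thesis
  proof (rule that[OF e, of "B / fact p"])
    fix z assume z: "z \<in> cball c e"
    have "norm ((deriv ^^ 0) F z - (\<Sum>i\<le>p. (deriv ^^ i) F c * (z - c) ^ i / fact i))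
        \<le> B * norm (z - c) ^ Suc p / fact p"
    proof (rule complex_Taylor[of "cball c e"])
      fix i x assume x: "x \<in> cball c e"
      have "((deriv ^^ i) F has_field_derivative deriv ((deriv ^^ i) F) x) (at x)"
        using hol assms(1) x e(2) by (intro holomorphic_derivI) auto
      then show "((deriv ^^ i) F has_field_derivative (deriv ^^ Suc i) F x) (at x within cball c e)"
        by (auto intro: has_field_derivative_at_within)
    qed (use B z e p in auto)
    then show "norm (F z - (\<Sum>n<q. (deriv ^^ n) F c / fact n * (z - c) ^ n))
        \<le> B / fact p * norm (z - c) ^ q"
      by (simp add: p lessThan_Suc_atMost)
  qed
qed

lemma has_integral_shifted_power:
  fixes a \<tau> :: real
  assumes "\<tau> \<ge> 0"
  shows "((\<lambda>t. complex_of_real (t - a) ^ n) has_integral of_real \<tau> ^ Suc n / of_nat (Suc n)) {a..a + \<tau>}"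
proof -
  have "((\<lambda>t. complex_of_real (t - a) ^ n) has_integral
      (of_real ((a + \<tau>) - a) ^ Suc n / of_nat (Suc n) - of_real (a - a) ^ Suc n / of_nat (Suc n))) {a..a + \<tau>}"
  proof (rule fundamental_theorem_of_calculus)
    fix t
    \<comment> \<open>The primitive is differentiated as a complex function and then restricted to
      the real line.\<close>
    have "((\<lambda>z. (z - of_real a) ^ Suc n / of_nat (Suc n)) has_field_derivative (of_real t - of_real a) ^ n)
       (at (complex_of_real t))"
      by (auto intro!: derivative_eq_intros simp del: of_nat_Suc power_Suc)
    then show "((\<lambda>t. complex_of_real (t - a) ^ Suc n / of_nat (Suc n)) has_vector_derivative
      complex_of_real (t - a) ^ n) (at t within {a..a + \<tau>})"
      using has_vector_derivative_real_field[of "\<lambda>z. (z - of_real a) ^ Suc n / of_nat (Suc n)"] by simp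
  qed (use assms in auto)
  then show ?thesis
    by simp
qed

section \<open>The error estimate\<close>

theorem lemma2:
  fixes q :: nat and T \<alpha> tn :: real
    and f :: "real \<Rightarrow> complex" and F :: "complex \<Rightarrow> complex" and U :: "complex set"
  assumes "q \<ge> 1" and "T > 0" and "\<alpha> > 0"
    and "Ck_on q {0<..T} f"
    and "open U" and "complex_of_real ` {0<..T} \<subseteq> U" and "F analytic_on U"
    and "\<And>t. t \<in> {0<..T} \<Longrightarrow> F (complex_of_real t) = f t"
    and "tn \<in> {0<..<T}"
  shows "(\<lambda>\<tau>::real.
            complex_of_real (\<tau> / \<alpha>) / of_nat q *
              scalar_prod (ones_vec q) (B_mat q \<alpha> *\<^sub>v sample_vec q F tn (\<tau> / \<alpha>))
            - integral {tn..tn + \<tau>} f)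
         \<in> O[at_right 0](\<lambda>\<tau>. complex_of_real \<tau> ^ q)"
proof -
  have hol: "F holomorphic_on U"
    using assms(7) by (rule analytic_imp_holomorphic)
  have "complex_of_real tn \<in> U"
    using assms(6,9) by auto
  then obtain e C where e: "e > 0" "cball (of_real tn) e \<subseteq> U" and
    C: "\<And>z. z \<in> cball (of_real tn) e \<Longrightarrow>
      norm (F z - (\<Sum>n<q. (deriv ^^ n) F (of_real tn) / fact n * (z - of_real tn) ^ n))
        \<le> C * norm (z - of_real tn) ^ q"
    using analytic_Taylor_remainder[OF assms(5) hol _ assms(1)] by blast
  \<comment> \<open>\<open>P\<close> is the Taylor polynomial and \<open>R\<close> the remainder,
    both in the displacement \<open>z\<close> from \<open>tn\<close>.\<close>
  define a where "a n = (deriv ^^ n) F (of_real tn) / fact n" for n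
  define P where "P z = (\<Sum>n<q. a n * z ^ n)" for z
  define R where "R z = F (of_real tn + z) - P z" for z
  have R: "norm (R z) \<le> C * norm z ^ q" if "norm z \<le> e" for z
    using C[of "of_real tn + z"] that by (simp add: R_def P_def a_def dist_norm)
  define W where "W = (\<Sum>m<q. norm (quad_weight q \<alpha> m))"
  \<comment> \<open>The three summands bound, in order, the defect of the rule on \<open>P\<close>,
    the rule applied to \<open>R\<close>, and the integral of \<open>R\<close>. Taking \<bar>C\<bar>
    avoids having to know the sign of \<open>C\<close>.\<close>
  define K where "K = norm (a (q - 1)) / \<alpha> ^ q / q + W * \<bar>C\<bar> / (\<alpha> * \<alpha> ^ q) / q + \<bar>C\<bar>"
  \<comment> \<open>The bound 1 lets a spare factor \<tau> be dropped in the remainder terms;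
    \<open>e\<close> keeps the interval of integration in the Taylor disc;
    \<open>\<alpha> * e\<close> gives \<open>r \<le> e\<close>, so the complex nodes lie there too;
    \<open>T - tn\<close> keeps the interval inside \<open>{0<..T}\<close>.\<close>
  define \<delta> where "\<delta> = Min {1, e, \<alpha> * e, T - tn}"
  have \<delta>: "\<delta> > 0" "\<delta> \<le> 1" "\<delta> \<le> e" "\<delta> \<le> \<alpha> * e" "\<delta> \<le> T - tn"
    using e assms by (auto simp: \<delta>_def)
  have norm_node: "norm (node q j) = 1" for j
    by (simp add: node_def)
  have main: "norm (complex_of_real (\<tau> / \<alpha>) / of_nat q *
              scalar_prod (ones_vec q) (B_mat q \<alpha> *\<^sub>v sample_vec q F tn (\<tau> / \<alpha>))
            - integral {tn..tn + \<tau>} f) \<le> K * norm (complex_of_real \<tau> ^ q)"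
    if \<tau>: "0 < \<tau>" "\<tau> < \<delta>" for \<tau>
  proof -
    define r where "r = \<tau> / \<alpha>"
    have r: "r > 0" "r \<le> e" "r * \<alpha> = \<tau>"
      using \<tau> \<delta> assms(3) by (auto simp: r_def field_simps)
    \<comment> \<open>\<open>Q\<close> is the rule and \<open>I\<close> the integral, both as linear
      functionals of a function of the displacement, so that each splits along \<open>P\<close> and
      \<open>R\<close>.\<close>
    define Q where "Q g = complex_of_real r / of_nat q
      * (\<Sum>m<q. quad_weight q \<alpha> m * g (of_real r * node q (Suc m)))" for g :: "complex \<Rightarrow> complex"
    define I where "I g = integral {tn..tn + \<tau>} (\<lambda>t. g (complex_of_real (t - tn)))" for g :: "complex \<Rightarrow> complex"
    have int_P: "((\<lambda>t. P (complex_of_real (t - tn))) has_integral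
        (\<Sum>n<q. a n * (of_real \<tau> ^ Suc n / of_nat (Suc n)))) {tn..tn + \<tau>}"
      unfolding P_def using \<tau>
      by (intro has_integral_sum has_integral_mult_right has_integral_shifted_power) auto
    have "Q P = (\<Sum>n<q. a n * (of_real r / of_nat q *
        (\<Sum>m<q. quad_weight q \<alpha> m * (of_real r * node q (Suc m)) ^ n)))"
      unfolding Q_def P_def sum_distrib_left by (subst sum.swap) (simp add: mult_ac)
    \<comment> \<open>Since \<open>q \<ge> 1\<close>, the condition \<open>Suc n = q\<close> becomes
      \<open>n = q - 1\<close>, and the defect is a single delta term.\<close>
    also have "\<dots> = (\<Sum>n<q. a n * (of_real \<tau> ^ Suc n / of_nat (Suc n))
        + (if n = q - 1 then a (q - 1) * (of_real r ^ q / of_nat q) else 0))"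
      using assms(1) by (intro sum.cong refl)
        (subst quadrature_monomial, auto simp: r(3) distrib_left simp del: power_Suc of_nat_Suc)
    also have "\<dots> = I P + a (q - 1) * (of_real r ^ q / of_nat q)"
      using assms(1) integral_unique[OF int_P] by (simp add: sum.distrib I_def)
    finally have QP: "Q P - I P = a (q - 1) * (of_real r ^ q / of_nat q)"
      by simp
    \<comment> \<open>The interval lies in \<open>{0<..T}\<close>, so \<open>f\<close> may be
      replaced by its analytic extension under the integral.\<close>
    have F_f: "F (complex_of_real t) = f t" if "t \<in> {tn..tn + \<tau>}" for t
      using that \<tau> \<delta> assms(8,9) by auto
    have "continuous_on {tn..tn + \<tau>} (\<lambda>t. F (complex_of_real t))"
      using \<tau> \<delta> assms(6,9)
      by (intro continuous_on_compose2[OF holomorphic_on_imp_continuous_on[OF hol]] continuous_intros) auto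
    then have "(\<lambda>t. F (complex_of_real t)) integrable_on {tn..tn + \<tau>}"
      by (rule integrable_continuous_real)
    then have int_F: "(\<lambda>t. F (of_real tn + of_real (t - tn))) integrable_on {tn..tn + \<tau>}"
      by simp
    have "integral {tn..tn + \<tau>} f = I (\<lambda>z. F (of_real tn + z))"
      unfolding I_def by (intro integral_cong) (simp add: F_f)
    also have "\<dots> = I P + I R"
      unfolding I_def R_def using integral_diff[OF int_F has_integral_integrable[OF int_P]] by simp
    finally have If: "integral {tn..tn + \<tau>} f = I P + I R" .
    have QF: "Q (\<lambda>z. F (of_real tn + z)) = Q P + Q R"
      unfolding Q_def R_def by (simp add: ring_distribs sum_subtractf)
    have IR: "norm (I R) \<le> (\<bar>C\<bar> * \<tau> ^ q) * (tn + \<tau> - tn)"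
      unfolding I_def
    proof (rule integral_bound)
      have "continuous_on {tn..tn + \<tau>} (\<lambda>t. P (complex_of_real (t - tn)))"
        unfolding P_def by (intro continuous_intros)
      with \<open>continuous_on {tn..tn + \<tau>} (\<lambda>t. F (complex_of_real t))\<close>
      show "continuous_on {tn..tn + \<tau>} (\<lambda>t. R (complex_of_real (t - tn)))"
        unfolding R_def by (intro continuous_on_diff) auto
      fix t assume t: "t \<in> {tn..tn + \<tau>}"
      then have "norm (complex_of_real (t - tn)) \<le> \<tau>"
        unfolding norm_of_real by auto
      then have "C * norm (complex_of_real (t - tn)) ^ q \<le> \<bar>C\<bar> * \<tau> ^ q"
        by (intro mult_mono power_mono) auto
      moreover have "norm (R (complex_of_real (t - tn))) \<le> C * norm (complex_of_real (t - tn)) ^ q"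
        using \<open>norm (complex_of_real (t - tn)) \<le> \<tau>\<close> \<tau> \<delta> by (intro R) auto
      ultimately show "norm (R (complex_of_real (t - tn))) \<le> \<bar>C\<bar> * \<tau> ^ q"
        by linarith
    qed (use \<tau> in auto)
    also have "\<dots> \<le> \<bar>C\<bar> * \<tau> ^ q"
      using \<tau> \<delta> by (simp add: mult_left_le)
    finally have IR: "norm (I R) \<le> \<bar>C\<bar> * \<tau> ^ q" .
    have "norm (\<Sum>m<q. quad_weight q \<alpha> m * R (of_real r * node q (Suc m))) \<le> W * (\<bar>C\<bar> * r ^ q)"
      unfolding W_def sum_distrib_right
    proof (rule sum_norm_le)
      fix m
      have "norm (R (of_real r * node q (Suc m))) \<le> C * r ^ q"
        using R[of "of_real r * node q (Suc m)"] r by (simp add: norm_mult norm_node)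
      also have "\<dots> \<le> \<bar>C\<bar> * r ^ q"
        using r by (intro mult_right_mono) auto
      finally show "norm (quad_weight q \<alpha> m * R (of_real r * node q (Suc m)))
          \<le> norm (quad_weight q \<alpha> m) * (\<bar>C\<bar> * r ^ q)"
        by (simp add: norm_mult mult_left_mono)
    qed
    then have "norm (Q R) \<le> r / q * (W * (\<bar>C\<bar> * r ^ q))"
      unfolding Q_def norm_mult using r by (intro mult_mono) (auto simp: norm_divide)
    \<comment> \<open>The factor \<open>r\<close> of the rule supplies one power of \<tau> beyond
      \<open>\<tau> ^ q\<close>; it is then estimated by 1.\<close>
    also have "\<dots> = \<tau> * (W * \<bar>C\<bar> / (\<alpha> * \<alpha> ^ q) / q * \<tau> ^ q)"
      by (simp add: r_def power_divide mult_ac)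
    also have "\<dots> \<le> W * \<bar>C\<bar> / (\<alpha> * \<alpha> ^ q) / q * \<tau> ^ q"
      using \<tau> \<delta> assms(3) by (intro mult_left_le_one_le) (auto simp: W_def sum_nonneg)
    finally have QR: "norm (Q R) \<le> W * \<bar>C\<bar> / (\<alpha> * \<alpha> ^ q) / q * \<tau> ^ q" .
    have "complex_of_real (\<tau> / \<alpha>) / of_nat q *
              scalar_prod (ones_vec q) (B_mat q \<alpha> *\<^sub>v sample_vec q F tn (\<tau> / \<alpha>))
            - integral {tn..tn + \<tau>} f = Q (\<lambda>z. F (of_real tn + z)) - integral {tn..tn + \<tau>} f"
      unfolding sample_vec_def scalar_prod_B_mat Q_def r_def ..
    also have "\<dots> = (Q P - I P) + Q R - I R"
      unfolding QF If by simp
    finally have eq: "complex_of_real (\<tau> / \<alpha>) / of_nat q *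
              scalar_prod (ones_vec q) (B_mat q \<alpha> *\<^sub>v sample_vec q F tn (\<tau> / \<alpha>))
            - integral {tn..tn + \<tau>} f = (Q P - I P) + Q R - I R" .
    \<comment> \<open>An equality: the defect in degree \<open>q - 1\<close> is what limits the
      estimate to order \<open>q\<close> whenever \<open>a (q - 1)\<close> is nonzero.\<close>
    have "norm (Q P - I P) = norm (a (q - 1)) / \<alpha> ^ q / q * \<tau> ^ q"
      unfolding QP using \<tau> assms(3) by (simp add: norm_mult norm_divide norm_power r_def power_divide)
    with QR IR have "norm ((Q P - I P) + Q R - I R) \<le> K * \<tau> ^ q"
      unfolding K_def distrib_right
      using norm_triangle_ineq4[of "Q P - I P + Q R" "I R"] norm_triangle_ineq[of "Q P - I P" "Q R"]
      by linarith
    then show ?thesis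
      unfolding eq using \<tau> by (simp add: norm_power)
  qed
  show ?thesis
    by (rule bigoI[of _ K])
      (use \<delta>(1) main in \<open>auto simp: eventually_at_right_field\<close>)
qed

end
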